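(* Let $|q|<1$ and let $f(-q)=(q;q)_\infty=\prod_{k\ge 1}(1-q^k)$. Set $$P=\frac{f(-q)f(-q^{2})}{q^{1/4}f(-q^{3})f(-q^{6})},\qquad Q=\frac{f(-q^2)f(-q^{4})}{q^{1/2}f(-q^{6})f(-q^{12})},$$ and write $X=\left(\frac{P}{Q}\right)^2+\left(\frac{Q}{P}\right)^2$. Then $$\left((PQ)^2+\left(\frac{9}{PQ}\right)^2\right)X=X^4-11X^2-8.$$
   Context: $(a;q)_\infty=\prod_{n\ge0}(1-aq^n)$. Fractional powers of $q$ are taken consistently, e.g. writing $q=e^{2\pi i\tau}$ with $\operatorname{Im}\tau>0$ and $q^r=e^{2\pi i r\tau}$. *)

theory Defs
  imports "HOL-Analysis.Analysis"
begin

definition qpoch_inf :: "complex \<Rightarrow> complex \<Rightarrow> complex" where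
  "qpoch_inf a q = (\<Prod>n. 1 - a * q ^ n)"

text \<open>
  Ramanujan's one-variable function, normalised as in \<open>f(-q) = (q; q)\<^sub>\<infinity>\<close>; hence the signs.
\<close>

definition ramanujan_f :: "complex \<Rightarrow> complex" where
  "ramanujan_f z = qpoch_inf (- z) (- z)"

text \<open>
  The branch of \<open>q\<^sup>r\<close> determined by the choice of \<open>\<tau>\<close> with \<open>q = exp (2 \<pi> \<i> \<tau>)\<close>; the principal
  power \<open>q powr r\<close> would instead depend on \<open>q\<close> alone.
\<close>

definition nome_power :: "complex \<Rightarrow> real \<Rightarrow> complex" where
  "nome_power \<tau> r = exp (2 * of_real pi * \<i> * of_real r * \<tau>)"

end

theory Submission
  imports Defs
begin

text \<open>
  All Euler products involved are monomials in the theta products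
  \<open>\<theta>(z) = (z; q\<^sup>6)\<^sub>\<infinity> (q\<^sup>6 / z; q\<^sup>6)\<^sub>\<infinity>\<close> at \<open>z = \<plusminus>q\<^sup>k\<close> and in \<open>(\<plusminus>q\<^sup>3; q\<^sup>6)\<^sub>\<infinity>\<close>, \<open>(\<plusminus>q\<^sup>6; q\<^sup>6)\<^sub>\<infinity>\<close>; in particular
  \<open>P\<^sup>4 = \<theta>(q)\<^sup>4 \<theta>(q\<^sup>2)\<^sup>8 / q\<close> and \<open>Q\<^sup>4 = \<theta>(q\<^sup>2)\<^sup>8 \<theta>(-q\<^sup>2)\<^sup>4 / q\<^sup>2\<close>. By the Jacobi triple product,
  \<open>\<theta>(x y) \<theta>(x / y)\<close> is a determinant of two theta series, which yields Weierstrass' three-term relation.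
  Four instances of it express \<open>1 + p\<close>, \<open>1 - p\<close>, \<open>1 + 2 p\<close> and \<open>2 + p\<close> as monomials, for a suitable
  monomial \<open>p\<close> (a Hauptmodul of level 12). So \<open>P\<^sup>4\<close> and \<open>Q\<^sup>4\<close> are rational functions of \<open>p\<close>, and as
  both sides of the claim depend only on \<open>P\<^sup>4\<close> and \<open>Q\<^sup>4\<close>, it becomes a polynomial identity in \<open>p\<close>.
\<close>

no_notation Infinite_Sum.abs_summable_on (infixr \<open>abs'_summable'_on\<close> 46)

section \<open>Bilateral theta series\<close>

text \<open>\<open>infsetsum\<close> is a Lebesgue integral for the counting measure, so reindexing,
  double sums and dominated convergence over the integers are all at hand.\<close>

definition bilateral_theta :: "complex \<Rightarrow> complex \<Rightarrow> complex" where
  "bilateral_theta s w = infsetsum (\<lambda>n::int. s powi (n * n) * w powi n) UNIV"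

lemma abs_summable_int:
  fixes f :: "int \<Rightarrow> 'b :: {banach, second_countable_topology}"
  assumes "summable (\<lambda>n. norm (f (int n)))" "summable (\<lambda>n. norm (f (- int n)))"
  shows "f abs_summable_on UNIV"
proof -
  have "f abs_summable_on (range int)"
    by (rule abs_summable_on_reindex) (use assms(1) in \<open>simp add: abs_summable_on_nat_iff'\<close>)
  moreover have "f abs_summable_on (range (\<lambda>n. - int n))"
    by (rule abs_summable_on_reindex) (use assms(2) in \<open>simp add: abs_summable_on_nat_iff'\<close>)
  ultimately have "f abs_summable_on (range int \<union> range (\<lambda>n. - int n))"
    by (rule abs_summable_on_union)
  moreover have "range int \<union> range (\<lambda>n. - int n) = UNIV"
    by (auto simp: image_iff) (metis int_cases2)
  ultimately show ?thesis by simp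
qed

text \<open>The term is \<open>(r ^ n * v) ^ n\<close>, and \<open>r ^ n * v\<close> drops below 1/2
  however large \<open>v\<close> is; hence both halves of the bilateral series converge for every
  \<open>w\<close>.\<close>

lemma summable_theta_nat:
  fixes r v :: real
  assumes "0 \<le> r" "r < 1" "0 \<le> v"
  shows "summable (\<lambda>n. r ^ (n * n) * v ^ n)"
proof -
  have "(\<lambda>n. r ^ n * v) \<longlonglongrightarrow> 0 * v"
    using assms by (intro tendsto_intros LIMSEQ_realpow_zero) auto
  then have "eventually (\<lambda>n. r ^ n * v < 1/2) sequentially"
    by (rule order_tendstoD) auto
  then have "eventually (\<lambda>n. norm (r ^ (n * n) * v ^ n) \<le> (1/2) ^ n) sequentially"
  proof eventually_elim
    case (elim n)
    have "r ^ (n * n) * v ^ n = (r ^ n * v) ^ n"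
      by (simp add: power_mult power_mult_distrib)
    moreover have "(r ^ n * v) ^ n \<le> (1/2) ^ n"
      using assms elim by (intro power_mono) auto
    ultimately show ?case using assms by simp
  qed
  then show ?thesis
    by (rule summable_comparison_test_ev) (rule summable_geometric, simp)
qed

lemma abs_summable_theta:
  fixes s w :: complex
  assumes "norm s < 1"
  shows "(\<lambda>n::int. s powi (n * n) * w powi n) abs_summable_on UNIV"
proof (rule abs_summable_int)
  have *: "(- int n) * (- int n) = int (n * n)" "int n * int n = int (n * n)" for n by auto
  show "summable (\<lambda>n. norm (s powi (int n * int n) * w powi int n))"
    using summable_theta_nat[of "norm s" "norm w"] assms
    unfolding * power_int_of_nat by (simp add: norm_mult norm_power)
  show "summable (\<lambda>n. norm (s powi (- int n * - int n) * w powi (- int n)))"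
    using summable_theta_nat[of "norm s" "norm (inverse w)"] assms
    unfolding * power_int_of_nat power_int_minus by (simp add: norm_mult norm_power norm_inverse power_inverse)
qed

text \<open>Quasi-periodicity, from the index shift by one and
  \<open>(n+1) * (n+1) = n * n + 2 * n + 1\<close>.\<close>

lemma bilateral_theta_shift:
  assumes "s \<noteq> 0" "norm s < 1" "w \<noteq> 0"
  shows "bilateral_theta s w = s * w * bilateral_theta s (s ^ 2 * w)"
proof -
  have bij: "bij_betw (\<lambda>n::int. n + 1) UNIV UNIV"
    by (rule bij_betw_byWitness[where f' = "\<lambda>n. n - 1"]) auto
  have "bilateral_theta s w = infsetsum (\<lambda>n::int. s powi ((n+1) * (n+1)) * w powi (n+1)) UNIV"
    unfolding bilateral_theta_def by (rule infsetsum_reindex_bij_betw[OF bij, symmetric])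
  also have "\<dots> = infsetsum (\<lambda>n::int. (s * w) * (s powi (n * n) * (s ^ 2 * w) powi n)) UNIV"
  proof (rule infsetsum_cong[OF _ refl])
    fix n :: int
    have "(n+1) * (n+1) = n * n + 2 * n + 1" by (simp add: algebra_simps)
    moreover have "(s ^ 2) powi n = s powi (2 * n)" by (simp add: power_int_power)
    ultimately show "s powi ((n+1) * (n+1)) * w powi (n+1) = (s * w) * (s powi (n * n) * (s ^ 2 * w) powi n)"
      using assms by (simp add: power_int_add power_int_mult_distrib)
  qed
  also have "\<dots> = s * w * bilateral_theta s (s ^ 2 * w)"
    unfolding bilateral_theta_def by (rule infsetsum_cmult_right) (rule abs_summable_theta[OF assms(2)])
  finally show ?thesis .
qed

lemmas abs_summable_on_product_int =
    abs_summable_on_product[where A = "UNIV :: int set" and B = "UNIV :: int set",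
      OF countableI_type countableI_type, unfolded UNIV_Times_UNIV]
  and infsetsum_product_int =
    infsetsum_product[where A = "UNIV :: int set" and B = "UNIV :: int set",
      OF countableI_type countableI_type, unfolded UNIV_Times_UNIV]

text \<open>The substitution \<open>(m, n) = (k + l, k - l)\<close>, respectively \<open>(k + l + 1, k - l)\<close>, splits the lattice
  by the parity of \<open>m + n\<close>; each half factors.\<close>

lemma bilateral_theta_mult:
  assumes "s \<noteq> 0" "norm s < 1" "x \<noteq> 0" "y \<noteq> 0"
  shows "bilateral_theta s (x * y) * bilateral_theta s (x / y) =
    bilateral_theta (s ^ 2) (x ^ 2) * bilateral_theta (s ^ 2) (y ^ 2) +
    s * x * y * bilateral_theta (s ^ 2) (s ^ 2 * x ^ 2) * bilateral_theta (s ^ 2) (s ^ 2 * y ^ 2)"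
proof -
  define F :: "int \<times> int \<Rightarrow> complex" where
    "F = (\<lambda>(m, n). (s powi (m * m) * (x * y) powi m) * (s powi (n * n) * (x / y) powi n))"
  define t where "t = s ^ 2"
  have t: "norm t < 1" unfolding t_def using assms by (simp add: norm_power power_less_one_iff)
  have tp: "t powi n = s powi (2 * n)" "(x ^ 2) powi n = x powi (2 * n)" "(y ^ 2) powi n = y powi (2 * n)" for n
    by (simp_all add: t_def power_int_power)
  define Ev Od where "Ev = {p :: int \<times> int. even (fst p + snd p)}" and "Od = {p :: int \<times> int. odd (fst p + snd p)}"
  have EO: "Ev \<union> Od = UNIV" "Ev \<inter> Od = {}" unfolding Ev_def Od_def by auto
  have F: "F abs_summable_on UNIV"
    unfolding F_def by (rule abs_summable_on_product_int) (rule abs_summable_theta[OF assms(2)])+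
  have "bilateral_theta s (x * y) * bilateral_theta s (x / y) = infsetsum F UNIV"
    unfolding F_def bilateral_theta_def
    by (rule infsetsum_product_int[symmetric]) (rule abs_summable_theta[OF assms(2)])+
  also have "\<dots> = infsetsum F Ev + infsetsum F Od"
    unfolding EO(1)[symmetric]
    by (rule infsetsum_Un_disjoint) (auto intro: abs_summable_on_subset[OF F] simp: EO(2))
  also have "infsetsum F Ev = bilateral_theta t (x ^ 2) * bilateral_theta t (y ^ 2)"
  proof -
    have even_halves: "(m + n) div 2 + (m - n) div 2 = m" "(m + n) div 2 - (m - n) div 2 = n"
      if "even (m + n)" for m n :: int
      using that by presburger+
    have bij: "bij_betw (\<lambda>(k, l). (k + l, k - l)) UNIV Ev"
      by (rule bij_betw_byWitness[where f' = "\<lambda>(m, n). ((m + n) div 2, (m - n) div 2)"])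
        (auto simp: Ev_def even_halves simp del: even_add)
    have "infsetsum F Ev = infsetsum (\<lambda>p. F (case p of (k, l) \<Rightarrow> (k + l, k - l))) UNIV"
      by (rule infsetsum_reindex_bij_betw[OF bij, symmetric])
    also have "\<dots> = infsetsum (\<lambda>(k, l). (t powi (k * k) * (x ^ 2) powi k) * (t powi (l * l) * (y ^ 2) powi l)) UNIV"
    proof (rule infsetsum_cong[OF _ refl], clarify)
      fix k l :: int
      have "s powi ((k + l) * (k + l)) * s powi ((k - l) * (k - l)) = s powi (2 * (k * k)) * s powi (2 * (l * l))"
        using assms by (simp add: power_int_add[symmetric] algebra_simps)
      moreover have "(x * y) powi (k + l) * (x / y) powi (k - l) = x powi (2 * k) * y powi (2 * l)"
      proof -
        have "x powi (k + l) * x powi (k - l) = x powi (2 * k)" "y powi (k + l) / y powi (k - l) = y powi (2 * l)"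
          using assms by (simp_all flip: power_int_add power_int_diff)
        then show ?thesis
          unfolding power_int_mult_distrib power_int_divide_distrib by (metis times_divide_eq_right mult.commute mult.left_commute mult.assoc)
      qed
      moreover have "F (k + l, k - l) = (s powi ((k + l) * (k + l)) * s powi ((k - l) * (k - l))) *
          ((x * y) powi (k + l) * (x / y) powi (k - l))"
        unfolding F_def prod.case by (simp only: mult_ac)
      ultimately show "F (k + l, k - l) = (t powi (k * k) * (x ^ 2) powi k) * (t powi (l * l) * (y ^ 2) powi l)"
        unfolding tp by (simp only: mult_ac)
    qed
    also have "\<dots> = bilateral_theta t (x ^ 2) * bilateral_theta t (y ^ 2)"
      unfolding bilateral_theta_def by (rule infsetsum_product_int) (rule abs_summable_theta[OF t])+
    finally show ?thesis .
  qed
  also have "infsetsum F Od = s * x * y * bilateral_theta t (t * x ^ 2) * bilateral_theta t (t * y ^ 2)"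
  proof -
    have odd_halves: "(m + n - 1) div 2 + (m - n - 1) div 2 + 1 = m"
      "(m + n - 1) div 2 - (m - n - 1) div 2 = n" if "odd (m + n)" for m n :: int
      using that by presburger+
    have bij: "bij_betw (\<lambda>(k, l). (k + l + 1, k - l)) UNIV Od"
      by (rule bij_betw_byWitness[where f' = "\<lambda>(m, n). ((m + n - 1) div 2, (m - n - 1) div 2)"])
        (auto simp: Od_def odd_halves simp del: even_add, presburger+)
    have "infsetsum F Od = infsetsum (\<lambda>p. F (case p of (k, l) \<Rightarrow> (k + l + 1, k - l))) UNIV"
      by (rule infsetsum_reindex_bij_betw[OF bij, symmetric])
    also have "\<dots> = infsetsum (\<lambda>p. s * x * y * (case p of (k, l) \<Rightarrow>
        (t powi (k * k) * (t * x ^ 2) powi k) * (t powi (l * l) * (t * y ^ 2) powi l))) UNIV"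
    proof (rule infsetsum_cong[OF _ refl], clarify)
      fix k l :: int
      have "(k + l + 1) * (k + l + 1) + (k - l) * (k - l) = 2 * (k * k) + 2 * k + 2 * (l * l) + 2 * l + 1"
        by (simp add: algebra_simps)
      then have "s powi ((k + l + 1) * (k + l + 1)) * s powi ((k - l) * (k - l)) =
          s * (s powi (2 * (k * k)) * s powi (2 * k)) * (s powi (2 * (l * l)) * s powi (2 * l))"
        using assms by (simp only: power_int_add[symmetric] simp_thms) (simp add: power_int_add)
      moreover have "(x * y) powi (k + l + 1) * (x / y) powi (k - l) = x * y * x powi (2 * k) * y powi (2 * l)"
      proof -
        have "x powi (k + l + 1) * x powi (k - l) = x powi (2 * k + 1)"
          "y powi (k + l + 1) / y powi (k - l) = y powi (2 * l + 1)"
          using assms by (simp_all flip: power_int_add power_int_diff)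
        then have "(x * y) powi (k + l + 1) * (x / y) powi (k - l) = x powi (2 * k + 1) * y powi (2 * l + 1)"
          unfolding power_int_mult_distrib power_int_divide_distrib by (metis times_divide_eq_right mult.commute mult.left_commute mult.assoc)
        then show ?thesis using assms by (simp add: power_int_add mult_ac)
      qed
      moreover have "F (k + l + 1, k - l) = (s powi ((k + l + 1) * (k + l + 1)) * s powi ((k - l) * (k - l))) *
          ((x * y) powi (k + l + 1) * (x / y) powi (k - l))"
        unfolding F_def prod.case by (simp only: mult_ac)
      ultimately have "F (k + l + 1, k - l) = (s * (s powi (2 * (k * k)) * s powi (2 * k)) * (s powi (2 * (l * l)) * s powi (2 * l)))
         * (x * y * x powi (2 * k) * y powi (2 * l))"
        by (simp only:)
      then show "F (k + l + 1, k - l) = s * x * y *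
          ((t powi (k * k) * (t * x ^ 2) powi k) * (t powi (l * l) * (t * y ^ 2) powi l))"
        unfolding power_int_mult_distrib tp by (simp add: mult_ac)
    qed
    also have "\<dots> = s * x * y * infsetsum (\<lambda>(k, l).
        (t powi (k * k) * (t * x ^ 2) powi k) * (t powi (l * l) * (t * y ^ 2) powi l)) UNIV"
      by (rule infsetsum_cmult_right, rule abs_summable_on_product_int) (rule abs_summable_theta[OF t])+
    also have "infsetsum (\<lambda>(k, l). (t powi (k * k) * (t * x ^ 2) powi k) * (t powi (l * l) * (t * y ^ 2) powi l)) UNIV
        = bilateral_theta t (t * x ^ 2) * bilateral_theta t (t * y ^ 2)"
      unfolding bilateral_theta_def by (rule infsetsum_product_int) (rule abs_summable_theta[OF t])+
    finally show ?thesis by (simp add: mult.assoc)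
  qed
  finally show ?thesis by (simp add: t_def)
qed

section \<open>The Jacobi triple product\<close>

lemma convergent_prod_qpoch:
  fixes a q :: complex
  assumes "norm q < 1"
  shows "convergent_prod (\<lambda>n. 1 - a * q ^ n)"
proof -
  have "summable (\<lambda>n. norm a * norm q ^ n)"
    using assms by (intro summable_mult summable_geometric) auto
  then have "summable (\<lambda>n. norm ((1 - a * q ^ n) - 1))"
    by (simp add: norm_mult norm_power)
  then show ?thesis
    by (intro abs_convergent_prod_imp_convergent_prod summable_imp_abs_convergent_prod)
qed

lemma qpoch_inf_LIMSEQ:
  assumes "norm q < 1"
  shows "(\<lambda>n. \<Prod>k<n. 1 - a * q ^ k) \<longlonglongrightarrow> qpoch_inf a q"
  using convergent_prod_LIMSEQ[OF convergent_prod_qpoch[OF assms, of a]]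
  unfolding qpoch_inf_def by (simp add: lessThan_Suc_atMost[symmetric] LIMSEQ_lessThan_iff_atMost)

lemma qpoch_inf_nonzero:
  assumes "norm q < 1" "norm a < 1"
  shows "qpoch_inf a q \<noteq> 0"
  unfolding qpoch_inf_def
proof (rule prodinf_nonzero[OF convergent_prod_qpoch[OF assms(1)]])
  fix i
  have "norm a * norm q ^ i \<le> norm a * 1"
    using assms by (intro mult_left_mono power_le_one) auto
  with assms have "norm (a * q ^ i) < 1" by (simp add: norm_mult norm_power)
  then show "1 - a * q ^ i \<noteq> 0" by auto
qed

text \<open>The factors are sorted by the residue of the exponent modulo \<open>m\<close>. This is
  done on partial products of length \<open>n * m\<close>, a subsequence with the same limit, so
  only finite products are rearranged.\<close>

lemma qpoch_inf_split:
  assumes "norm q < 1" "0 < m"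
  shows "qpoch_inf a q = (\<Prod>j<m. qpoch_inf (a * q ^ j) (q ^ m))"
proof (rule LIMSEQ_unique)
  have "(\<lambda>n. \<Prod>k<n * m. 1 - a * q ^ k) \<longlonglongrightarrow> qpoch_inf a q"
    using filterlim_compose[OF qpoch_inf_LIMSEQ[OF assms(1)], of "\<lambda>n. n * m" sequentially a] assms(2)
    by (simp add: mult_nat_right_at_top)
  moreover have "(\<Prod>k<n * m. 1 - a * q ^ k) = (\<Prod>j<m. \<Prod>k<n. 1 - a * q ^ j * (q ^ m) ^ k)" for n
  proof -
    have "(\<Prod>k<n * m. 1 - a * q ^ k) = (\<Prod>k<n. prod (\<lambda>i. 1 - a * q ^ i) {k * m..<k * m + m})"
      by (rule prod.nat_group[symmetric])
    also have "\<dots> = (\<Prod>k<n. \<Prod>j<m. 1 - a * q ^ j * (q ^ m) ^ k)"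
    proof (rule prod.cong[OF refl])
      fix k
      have "prod (\<lambda>i. 1 - a * q ^ i) {0 + k * m..<m + k * m} = prod (\<lambda>i. 1 - a * q ^ (i + k * m)) {0..<m}"
        by (rule prod.shift_bounds_nat_ivl)
      then show "prod (\<lambda>i. 1 - a * q ^ i) {k * m..<k * m + m} = (\<Prod>j<m. 1 - a * q ^ j * (q ^ m) ^ k)"
        by (simp add: lessThan_atLeast0 power_add power_mult[symmetric] mult_ac add.commute)
    qed
    also have "\<dots> = (\<Prod>j<m. \<Prod>k<n. 1 - a * q ^ j * (q ^ m) ^ k)" by (rule prod.swap)
    finally show ?thesis .
  qed
  ultimately show "(\<lambda>n. \<Prod>j<m. \<Prod>k<n. 1 - a * q ^ j * (q ^ m) ^ k) \<longlonglongrightarrow> qpoch_inf a q" by simp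
  have "norm (q ^ m) < 1" using assms by (simp add: norm_power power_less_one_iff)
  then show "(\<lambda>n. \<Prod>j<m. \<Prod>k<n. 1 - a * q ^ j * (q ^ m) ^ k) \<longlonglongrightarrow> (\<Prod>j<m. qpoch_inf (a * q ^ j) (q ^ m))"
    by (intro tendsto_prod qpoch_inf_LIMSEQ)
qed

text \<open>Factorwise a difference of squares; it later converts products with base
  \<open>q ^ 12\<close> into products with base \<open>q ^ 6\<close>.\<close>

lemma qpoch_inf_square:
  assumes "norm q < 1"
  shows "qpoch_inf (a ^ 2) (q ^ 2) = qpoch_inf a q * qpoch_inf (- a) q"
proof -
  have "qpoch_inf a q * qpoch_inf (- a) q = (\<Prod>n. (1 - a * q ^ n) * (1 - - a * q ^ n))"
    unfolding qpoch_inf_def using assms by (intro prodinf_mult convergent_prod_qpoch)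
  also have "\<dots> = qpoch_inf (a ^ 2) (q ^ 2)"
    unfolding qpoch_inf_def
    by (intro prodinf_cong) (simp add: algebra_simps power2_eq_square power_mult_distrib)
  finally show ?thesis by simp
qed

section \<open>Finite form of the triple product and its limit\<close>

text \<open>Extending \<open>1 / (t; t)\<^sub>m\<close> by zero to negative \<open>m\<close> makes its recursion, and hence that of the
  Gaussian binomials in the finite triple product, hold for all integers without boundary cases.\<close>

definition recip_qfact :: "complex \<Rightarrow> int \<Rightarrow> complex" where
  "recip_qfact t m = (if m < 0 then 0 else inverse (\<Prod>k<nat m. 1 - t * t ^ k))"

lemma recip_qfact_rec:
  assumes "norm t < 1" "t \<noteq> 0"
  shows "recip_qfact t (m - 1) = (1 - t powi m) * recip_qfact t m"
proof (cases "m \<le> 0")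
  case True
  \<comment> \<open>At \<open>m = 0\<close> the factor \<open>1 - t powi 0\<close> vanishes,
    matching the value 0 assigned at -1.\<close>
  then show ?thesis by (cases "m = 0") (auto simp: recip_qfact_def)
next
  case False
  then obtain k where k: "m = int (Suc k)" by (metis not_le zero_less_imp_eq_int Suc_pred)
  have "norm (t * t ^ k) < 1" using assms
    by (metis norm_power power_Suc power_less_one_iff norm_ge_zero zero_less_Suc)
  then have "1 - t * t ^ k \<noteq> 0" by auto
  moreover have "t powi m = t * t ^ k" unfolding k power_int_of_nat by simp
  moreover have "nat (1 + int k) = Suc k" by simp
  ultimately show ?thesis by (simp add: recip_qfact_def k)
qed

text \<open>With \<open>t = s ^ 2\<close>, the first two factors form the Gaussian binomial
  coefficient of 2n over n + j in base \<open>t\<close>. It vanishes for |j| > n, so the finite sum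
  can be taken over all integers.\<close>

definition jtp_term :: "complex \<Rightarrow> complex \<Rightarrow> nat \<Rightarrow> int \<Rightarrow> complex" where
  "jtp_term s w n j = (\<Prod>k<2 * n. 1 - s ^ 2 * (s ^ 2) ^ k) *
     (recip_qfact (s ^ 2) (int n - j) * recip_qfact (s ^ 2) (int n + j)) * (s powi (j * j) * w powi j)"

lemma recip_qfact_LIMSEQ:
  assumes "norm t < 1"
  shows "(\<lambda>n. recip_qfact t (int n + j)) \<longlonglongrightarrow> inverse (qpoch_inf t t)"
proof -
  have lim: "(\<lambda>n. inverse (\<Prod>k<n. 1 - t * t ^ k)) \<longlonglongrightarrow> inverse (qpoch_inf t t)"
    using qpoch_inf_LIMSEQ[OF assms] qpoch_inf_nonzero[OF assms assms] by (rule tendsto_inverse)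
  have "filterlim (\<lambda>n. nat (int n + j)) sequentially sequentially"
    unfolding filterlim_at_top eventually_sequentially
  proof
    fix Z
    show "\<exists>N. \<forall>n\<ge>N. Z \<le> nat (int n + j)"
      by (rule exI[of _ "Z + nat (- j)"]) auto
  qed
  from filterlim_compose[OF lim this]
  have "(\<lambda>n. inverse (\<Prod>k<nat (int n + j). 1 - t * t ^ k)) \<longlonglongrightarrow> inverse (qpoch_inf t t)" .
  moreover have "eventually (\<lambda>n. inverse (\<Prod>k<nat (int n + j). 1 - t * t ^ k) = recip_qfact t (int n + j)) sequentially"
    using eventually_ge_at_top[of "nat (- j)"] by eventually_elim (auto simp: recip_qfact_def)
  ultimately show ?thesis by (rule Lim_transform_eventually)
qed

text \<open>The products (t; t)_n and their reciprocals converge, the limit being nonzero, and so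
  are bounded. The constant is therefore uniform in both \<open>n\<close> and \<open>j\<close>, as
  domination requires.\<close>

lemma jtp_term_bound:
  assumes "norm s < 1"
  obtains C where "\<And>n j. norm (jtp_term s w n j) \<le> C * norm (s powi (j * j) * w powi j)"
proof -
  define t where "t = s ^ 2"
  have t: "norm t < 1" unfolding t_def using assms by (simp add: norm_power power_less_one_iff)
  have "Bseq (\<lambda>n. \<Prod>k<n. 1 - t * t ^ k)"
    by (intro convergent_imp_Bseq[OF convergentI[OF qpoch_inf_LIMSEQ[OF t, of t]]])
  then obtain B where B: "B > 0" "\<And>n. norm (\<Prod>k<n. 1 - t * t ^ k) \<le> B"
    by (auto simp: Bseq_def)
  have "Bseq (\<lambda>n. inverse (\<Prod>k<n. 1 - t * t ^ k))"
    using qpoch_inf_nonzero[OF t t]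
    by (intro convergent_imp_Bseq[OF convergentI[OF tendsto_inverse[OF qpoch_inf_LIMSEQ[OF t, of t]]]])
  then obtain B' where B': "B' > 0" "\<And>n. norm (inverse (\<Prod>k<n. 1 - t * t ^ k)) \<le> B'"
    by (auto simp: Bseq_def)
  have R: "norm (recip_qfact t m) \<le> B'" for m
    using B' by (auto simp: recip_qfact_def less_imp_le)
  have "norm (jtp_term s w n j) \<le> B * (B' * B') * norm (s powi (j * j) * w powi j)" for n j
    unfolding jtp_term_def t_def[symmetric] norm_mult[of "_ * _" "s powi (j * j) * w powi j"]
      norm_mult[of "prod _ _"] norm_mult[of "recip_qfact _ _"]
    using less_imp_le[OF B(1)] less_imp_le[OF B'(1)]
    by (intro mult_mono B(2) R mult_nonneg_nonneg order_refl norm_ge_zero)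
  then show ?thesis by (rule that)
qed

lemma abs_summable_jtp_term:
  assumes "norm s < 1"
  shows "jtp_term s w n abs_summable_on UNIV"
proof -
  obtain C where C: "\<And>n j. norm (jtp_term s w n j) \<le> C * norm (s powi (j * j) * w powi j)"
    using jtp_term_bound[OF assms] by blast
  have "(\<lambda>j. C * norm (s powi (j * j) * w powi j)) abs_summable_on UNIV"
    using abs_summable_theta[OF assms, of w] by (intro abs_summable_on_cmult_right) simp
  then show ?thesis by (rule abs_summable_on_comparison_test') (rule C)
qed

text \<open>With E = \<open>s ^ (2 * n + 1)\<close>, the next factor is (1 + w E) (1 + E / w) = 1 +
  E^2 + w E + E / w; the recursion compares the terms containing \<open>w powi j\<close>.\<close>

lemma jtp_term_Suc:
  assumes "s \<noteq> 0" "norm s < 1" "w \<noteq> 0"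
  shows "jtp_term s w (Suc n) j = (1 + s ^ (4 * n + 2)) * jtp_term s w n j
    + s ^ (2 * n + 1) * w * jtp_term s w n (j - 1) + s ^ (2 * n + 1) / w * jtp_term s w n (j + 1)"
proof -
  define t where "t = s ^ 2"
  define u where "u = s powi j"
  define r where "r = recip_qfact t (int n + 1 - j)"
  define r' where "r' = recip_qfact t (int n + 1 + j)"
  \<comment> \<open>Together with \<open>t\<close>, the quantities \<open>\<alpha>\<close> = t^(n-j)
    and \<open>\<beta>\<close> = t^(n+j) carry all dependence on \<open>n\<close> and
    \<open>j\<close> that remains once \<open>PP * (r * r') * z\<close> is factored out.\<close>
  define \<alpha> where "\<alpha> = s ^ (2 * n) / u ^ 2"
  define \<beta> where "\<beta> = s ^ (2 * n) * u ^ 2"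
  define PP where "PP = (\<Prod>k<2 * n. 1 - t * t ^ k)"
  have t: "norm t < 1" "t \<noteq> 0"
    unfolding t_def using assms by (simp_all add: norm_power power_less_one_iff)
  have u0: "u \<noteq> 0" using assms by (simp add: u_def)
  have tp: "t powi int n = s ^ (2 * n)" "t powi j = u ^ 2"
    by (simp_all add: t_def u_def power_int_power power_int_power' power_mult[symmetric] mult.commute)
  have pw: "t powi (int n - j) = \<alpha>" "t powi (int n + j) = \<beta>"
      "t powi (int n + 1 - j) = t * \<alpha>" "t powi (int n + 1 + j) = t * \<beta>"
    using t tp by (simp_all add: \<alpha>_def \<beta>_def power_int_add power_int_diff del: power_int_of_nat)
  note rec = recip_qfact_rec[OF t]
  have R: "recip_qfact t (int n - j) = (1 - t * \<alpha>) * r" "recip_qfact t (int n + j) = (1 - t * \<beta>) * r'"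
    using rec[of "int n + 1 - j"] rec[of "int n + 1 + j"] by (simp_all add: r_def r'_def pw)
  have R2: "recip_qfact t (int n - (j + 1)) = (1 - \<alpha>) * ((1 - t * \<alpha>) * r)"
      "recip_qfact t (int n + (j - 1)) = (1 - \<beta>) * ((1 - t * \<beta>) * r')"
    using rec[of "int n - j"] rec[of "int n + j"] by (simp_all only: R pw diff_diff_eq add_diff_eq)
  have \<alpha>\<beta>: "\<alpha> * \<beta> = t ^ (2 * n)"
    using u0 by (simp add: \<alpha>_def \<beta>_def t_def power_mult[symmetric] power_add[symmetric])
  have PS: "(\<Prod>k<2 * Suc n. 1 - t * t ^ k) = PP * (1 - t * (\<alpha> * \<beta>)) * (1 - t ^ 2 * (\<alpha> * \<beta>))"
    by (simp add: PP_def \<alpha>\<beta> power2_eq_square mult.assoc)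
  have s4: "s ^ (4 * n + 2) = t * (\<alpha> * \<beta>)"
  proof -
    have "4 * n + 2 = 2 + 2 * (2 * n)" by simp
    then show ?thesis by (simp only: \<alpha>\<beta> t_def power_add power_mult)
  qed
  define z where "z = s powi (j * j) * w powi j"
  have "(j - 1) * (j - 1) = j * j + 1 - 2 * j" "(j + 1) * (j + 1) = j * j + 1 + 2 * j"
    by (simp_all add: algebra_simps)
  moreover have "s powi (2 * j) = u ^ 2" by (simp add: u_def power_int_power' mult.commute)
  moreover have "s powi (a + 1 - 2 * j) = s powi a * s / s powi (2 * j)"
      "s powi (a + 1 + 2 * j) = s powi a * s * s powi (2 * j)" for a
    using assms(1) by (simp_all add: power_int_add power_int_diff)
  ultimately have sj: "s powi ((j - 1) * (j - 1)) = s powi (j * j) * s / u ^ 2"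
      "s powi ((j + 1) * (j + 1)) = s powi (j * j) * s * u ^ 2"
    by (simp_all only:)
  have wj: "w powi (j - 1) = w powi j / w" "w powi (j + 1) = w powi j * w"
    using assms by (simp_all add: power_int_add power_int_diff)
  have s2: "s ^ (2 * n + 1) = s * s ^ (2 * n)" by simp
  have z: "s ^ (2 * n + 1) * w * (s powi ((j - 1) * (j - 1)) * w powi (j - 1)) = t * \<alpha> * z"
      "s ^ (2 * n + 1) / w * (s powi ((j + 1) * (j + 1)) * w powi (j + 1)) = t * \<beta> * z"
    unfolding sj wj s2 z_def \<alpha>_def \<beta>_def t_def power2_eq_square
    using assms(3) u0 by (simp_all add: divide_simps)
  have n1: "int (Suc n) - j = int n + 1 - j" "int (Suc n) + j = int n + 1 + j"
    "int n - (j - 1) = int n + 1 - j" "int n + (j + 1) = int n + 1 + j" by simp_all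
  \<comment> \<open>This polynomial identity is the recursion divided by the common factor
    \<open>PP * (r * r') * z\<close>.\<close>
  have id: "(1 - t * (\<alpha> * \<beta>)) * (1 - t ^ 2 * (\<alpha> * \<beta>)) = (1 + t * (\<alpha> * \<beta>)) * ((1 - t * \<alpha>) * (1 - t * \<beta>))
     + t * \<alpha> * ((1 - \<beta>) * (1 - t * \<beta>)) + t * \<beta> * ((1 - \<alpha>) * (1 - t * \<alpha>))"
    by algebra
  have "PP * (1 - t * (\<alpha> * \<beta>)) * (1 - t ^ 2 * (\<alpha> * \<beta>)) * (r * r') * z =
      ((1 - t * (\<alpha> * \<beta>)) * (1 - t ^ 2 * (\<alpha> * \<beta>))) * (PP * (r * r') * z)"
    by (simp only: mult_ac)
  also have "\<dots> = (1 + t * (\<alpha> * \<beta>)) * (PP * ((1 - t * \<alpha>) * r * ((1 - t * \<beta>) * r')) * z)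
     + PP * (r * ((1 - \<beta>) * ((1 - t * \<beta>) * r'))) * (t * \<alpha> * z)
     + PP * ((1 - \<alpha>) * ((1 - t * \<alpha>) * r) * r') * (t * \<beta> * z)"
    unfolding id distrib_right[of _ _ "PP * (r * r') * z"] by (simp only: mult_ac)
  finally have key: "PP * (1 - t * (\<alpha> * \<beta>)) * (1 - t ^ 2 * (\<alpha> * \<beta>)) * (r * r') * z =
      (1 + t * (\<alpha> * \<beta>)) * (PP * ((1 - t * \<alpha>) * r * ((1 - t * \<beta>) * r')) * z)
     + PP * (r * ((1 - \<beta>) * ((1 - t * \<beta>) * r'))) * (t * \<alpha> * z)
     + PP * ((1 - \<alpha>) * ((1 - t * \<alpha>) * r) * r') * (t * \<beta> * z)" .
  have T: "jtp_term s w m i = (\<Prod>k<2 * m. 1 - t * t ^ k) *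
      (recip_qfact t (int m - i) * recip_qfact t (int m + i)) * (s powi (i * i) * w powi i)" for m i
    by (simp only: jtp_term_def t_def)
  have "jtp_term s w (Suc n) j = PP * (1 - t * (\<alpha> * \<beta>)) * (1 - t ^ 2 * (\<alpha> * \<beta>)) * (r * r') * z"
    unfolding T n1 PS z_def r_def r'_def ..
  moreover have "(1 + s ^ (4 * n + 2)) * jtp_term s w n j =
      (1 + t * (\<alpha> * \<beta>)) * (PP * ((1 - t * \<alpha>) * r * ((1 - t * \<beta>) * r')) * z)"
    unfolding T R s4 z_def PP_def ..
  moreover have "s ^ (2 * n + 1) * w * jtp_term s w n (j - 1) =
      PP * (r * ((1 - \<beta>) * ((1 - t * \<beta>) * r'))) * (t * \<alpha> * z)"
    unfolding z(1)[symmetric] T R2 n1 PP_def r_def by (simp only: mult_ac)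
  moreover have "s ^ (2 * n + 1) / w * jtp_term s w n (j + 1) =
      PP * ((1 - \<alpha>) * ((1 - t * \<alpha>) * r) * r') * (t * \<beta> * z)"
    unfolding z(2)[symmetric] T R2 n1 PP_def r'_def by (simp only: mult_ac)
  ultimately show ?thesis by (simp only: key)
qed

lemma infsetsum_linear_combination3:
  fixes f g h :: "'a \<Rightarrow> complex"
  assumes "f abs_summable_on A" "g abs_summable_on A" "h abs_summable_on A"
  shows "infsetsum (\<lambda>x. a * f x + b * g x + c * h x) A =
    a * infsetsum f A + b * infsetsum g A + c * infsetsum h A"
proof -
  have "(\<lambda>x. a * f x) abs_summable_on A" "(\<lambda>x. b * g x) abs_summable_on A" "(\<lambda>x. c * h x) abs_summable_on A"
    using assms by auto
  then show ?thesis
    using assms by (simp add: infsetsum_add abs_summable_on_add infsetsum_cmult_right)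
qed

text \<open>Summing the recursion over all integers turns the shifted sums back into the same sum,
  so each step multiplies it by one pair of factors.\<close>

lemma finite_jacobi_triple_product:
  assumes "s \<noteq> 0" "norm s < 1" "w \<noteq> 0"
  shows "(\<Prod>k<n. (1 + w * s ^ (2 * k + 1)) * (1 + s ^ (2 * k + 1) / w)) = infsetsum (jtp_term s w n) UNIV"
proof (induction n)
  case 0
  \<comment> \<open>For \<open>j\<close> other than 0, one of \<open>- j\<close> and
    \<open>j\<close> is negative, and \<open>recip_qfact\<close> vanishes there.\<close>
  have "infsetsum (jtp_term s w 0) UNIV = infsetsum (jtp_term s w 0) {0}"
    by (rule infsetsum_cong_neutral) (auto simp: jtp_term_def recip_qfact_def)
  also have "\<dots> = 1" by (simp add: jtp_term_def recip_qfact_def)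
  finally show ?case by simp
next
  case (Suc n)
  let ?f = "jtp_term s w n"
  note sm = abs_summable_jtp_term[OF assms(2), of w n]
  have bij: "bij_betw (\<lambda>j::int. j - 1) UNIV UNIV" "bij_betw (\<lambda>j::int. j + 1) UNIV UNIV"
    by (rule bij_betw_byWitness[where f' = "\<lambda>n. n + 1"]; auto)
       (rule bij_betw_byWitness[where f' = "\<lambda>n. n - 1"]; auto)
  note sh = infsetsum_reindex_bij_betw[OF bij(1), of ?f] infsetsum_reindex_bij_betw[OF bij(2), of ?f]
  have sms: "(\<lambda>j. ?f (j - 1)) abs_summable_on UNIV" "(\<lambda>j. ?f (j + 1)) abs_summable_on UNIV"
    using abs_summable_on_reindex_bij_betw[OF bij(1), of ?f] abs_summable_on_reindex_bij_betw[OF bij(2), of ?f] sm by simp_all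
  have "infsetsum (jtp_term s w (Suc n)) UNIV = infsetsum (\<lambda>j. (1 + s ^ (4 * n + 2)) * ?f j
    + s ^ (2 * n + 1) * w * ?f (j - 1) + s ^ (2 * n + 1) / w * ?f (j + 1)) UNIV"
    by (rule infsetsum_cong[OF jtp_term_Suc[OF assms] refl])
  also have "\<dots> = (1 + s ^ (4 * n + 2)) * infsetsum ?f UNIV
    + s ^ (2 * n + 1) * w * infsetsum (\<lambda>j. ?f (j - 1)) UNIV + s ^ (2 * n + 1) / w * infsetsum (\<lambda>j. ?f (j + 1)) UNIV"
    by (rule infsetsum_linear_combination3[OF sm sms])
  also have "\<dots> = (1 + w * s ^ (2 * n + 1)) * (1 + s ^ (2 * n + 1) / w) * infsetsum ?f UNIV"
  proof -
    have "s ^ (4 * n + 2) = s ^ (2 * n + 1) * s ^ (2 * n + 1)" by (simp add: power_add[symmetric])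
    moreover have "(1 + E * E) * S + E * w * S + E / w * S = (1 + w * E) * (1 + E / w) * S" for E S
      using assms(3) by (simp add: field_simps)
    from this[of "s ^ (2 * n + 1)" "infsetsum ?f UNIV"]
    have "(1 + s ^ (2 * n + 1) * s ^ (2 * n + 1)) * infsetsum ?f UNIV + s ^ (2 * n + 1) * w * infsetsum ?f UNIV
        + s ^ (2 * n + 1) / w * infsetsum ?f UNIV
      = (1 + w * s ^ (2 * n + 1)) * (1 + s ^ (2 * n + 1) / w) * infsetsum ?f UNIV" .
    ultimately show ?thesis by (simp only: sh)
  qed
  finally have "infsetsum (jtp_term s w (Suc n)) UNIV =
      infsetsum ?f UNIV * ((1 + w * s ^ (2 * n + 1)) * (1 + s ^ (2 * n + 1) / w))"
    by (simp only: mult.commute)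
  then show ?case unfolding prod.lessThan_Suc Suc.IH by (rule sym)
qed

text \<open>In the finite form the Gaussian binomials tend to 1 / (t; t)_oo for each fixed
  \<open>j\<close>. Dominated convergence passes this limit through the sum.\<close>

theorem jacobi_triple_product:
  assumes "s \<noteq> 0" "norm s < 1" "w \<noteq> 0"
  shows "bilateral_theta s w = qpoch_inf (- (w * s)) (s ^ 2) * qpoch_inf (- (s / w)) (s ^ 2) * qpoch_inf (s ^ 2) (s ^ 2)"
proof -
  define t where "t = s ^ 2"
  have t: "norm t < 1" unfolding t_def using assms by (simp add: norm_power power_less_one_iff)
  let ?P = "qpoch_inf t t"
  have P0: "?P \<noteq> 0" by (rule qpoch_inf_nonzero[OF t t])
  obtain C where C: "\<And>n j. norm (jtp_term s w n j) \<le> C * norm (s powi (j * j) * w powi j)"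
    using jtp_term_bound[OF assms(2)] by blast
  have "(\<lambda>n. infsetsum (jtp_term s w n) UNIV) \<longlonglongrightarrow> infsetsum (\<lambda>j. inverse ?P * (s powi (j * j) * w powi j)) UNIV"
    unfolding infsetsum_def
  proof (rule integral_dominated_convergence)
    show "integrable (count_space UNIV) (\<lambda>j. C * norm (s powi (j * j) * w powi j))"
      unfolding abs_summable_on_def[symmetric]
      using abs_summable_theta[OF assms(2), of w] by (intro abs_summable_on_cmult_right) simp
    show "AE j in count_space UNIV. (\<lambda>n. jtp_term s w n j) \<longlonglongrightarrow> inverse ?P * (s powi (j * j) * w powi j)"
    proof (rule AE_I2)
      fix j
      have "filterlim (\<lambda>n::nat. 2 * n) sequentially sequentially"
        by (simp add: mult_nat_left_at_top)
      from filterlim_compose[OF qpoch_inf_LIMSEQ[OF t, of t] this]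
      have "(\<lambda>n. \<Prod>k<2 * n. 1 - t * t ^ k) \<longlonglongrightarrow> ?P" .
      moreover have "(\<lambda>n. recip_qfact t (int n - j)) \<longlonglongrightarrow> inverse ?P"
        using recip_qfact_LIMSEQ[OF t, of "- j"] by simp
      ultimately have "(\<lambda>n. jtp_term s w n j) \<longlonglongrightarrow> ?P * (inverse ?P * inverse ?P) * (s powi (j * j) * w powi j)"
        unfolding jtp_term_def t_def[symmetric]
        by (intro tendsto_intros recip_qfact_LIMSEQ[OF t])
      then show "(\<lambda>n. jtp_term s w n j) \<longlonglongrightarrow> inverse ?P * (s powi (j * j) * w powi j)"
        using P0 by (simp add: mult.assoc[symmetric])
    qed
    show "AE j in count_space UNIV. norm (jtp_term s w n j) \<le> C * norm (s powi (j * j) * w powi j)" for n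
      using C by (intro AE_I2)
  qed auto
  moreover have "infsetsum (\<lambda>j. inverse ?P * (s powi (j * j) * w powi j)) UNIV = inverse ?P * bilateral_theta s w"
    unfolding bilateral_theta_def by (rule infsetsum_cmult_right) (rule abs_summable_theta[OF assms(2)])
  ultimately have 1: "(\<lambda>n. \<Prod>k<n. (1 + w * s ^ (2 * k + 1)) * (1 + s ^ (2 * k + 1) / w)) \<longlonglongrightarrow> inverse ?P * bilateral_theta s w"
    unfolding finite_jacobi_triple_product[OF assms] by simp
  have "(\<Prod>k<n. (1 + w * s ^ (2 * k + 1)) * (1 + s ^ (2 * k + 1) / w)) =
      (\<Prod>k<n. 1 - - (w * s) * t ^ k) * (\<Prod>k<n. 1 - - (s / w) * t ^ k)" for n
    unfolding prod.distrib[symmetric] t_def by (simp add: power_mult[symmetric] mult_ac)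
  then have 2: "(\<lambda>n. \<Prod>k<n. (1 + w * s ^ (2 * k + 1)) * (1 + s ^ (2 * k + 1) / w)) \<longlonglongrightarrow>
      qpoch_inf (- (w * s)) t * qpoch_inf (- (s / w)) t"
    by (simp only:) (intro tendsto_mult qpoch_inf_LIMSEQ[OF t])
  have "bilateral_theta s w = (inverse ?P * bilateral_theta s w) * ?P"
    using P0 by simp
  also have "inverse ?P * bilateral_theta s w = qpoch_inf (- (w * s)) t * qpoch_inf (- (s / w)) t"
    by (rule LIMSEQ_unique[OF 1 2])
  finally show ?thesis by (simp only: t_def)
qed

section \<open>Theta products\<close>

lemma qpoch_inf_shift:
  assumes "norm q < 1"
  shows "qpoch_inf a q = (1 - a) * qpoch_inf (a * q) q"
proof -
  have "(\<lambda>n. \<Prod>k<Suc n. 1 - a * q ^ k) \<longlonglongrightarrow> qpoch_inf a q"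
    by (rule LIMSEQ_Suc[OF qpoch_inf_LIMSEQ[OF assms]])
  moreover have "(\<Prod>k<Suc n. 1 - a * q ^ k) = (1 - a) * (\<Prod>k<n. 1 - a * q * q ^ k)" for n
    by (simp add: prod.lessThan_Suc_shift mult_ac del: prod.lessThan_Suc)
  moreover have "(\<lambda>n. (1 - a) * (\<Prod>k<n. 1 - a * q * q ^ k)) \<longlonglongrightarrow> (1 - a) * qpoch_inf (a * q) q"
    by (intro tendsto_intros qpoch_inf_LIMSEQ[OF assms])
  ultimately show ?thesis by (auto intro: LIMSEQ_unique)
qed

definition theta_prod :: "complex \<Rightarrow> complex \<Rightarrow> complex" where
  "theta_prod t z = qpoch_inf z t * qpoch_inf (t / z) t"

text \<open>The argument \<open>w = - (z / s)\<close> makes \<open>- (w * s) = z\<close> and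
  \<open>- (s / w) = s ^ 2 / z\<close> in the triple product.\<close>

lemma theta_prod_eq_bilateral_theta:
  assumes "s \<noteq> 0" "norm s < 1" "z \<noteq> 0"
  shows "theta_prod (s ^ 2) z * qpoch_inf (s ^ 2) (s ^ 2) = bilateral_theta s (- (z / s))"
  using jacobi_triple_product[OF assms(1,2), of "- (z / s)"] assms
  by (simp add: theta_prod_def power2_eq_square)

lemma theta_prod_reflect: "t \<noteq> 0 \<Longrightarrow> z \<noteq> 0 \<Longrightarrow> theta_prod t (t / z) = theta_prod t z"
  by (simp add: theta_prod_def mult_ac)

text \<open>Peeling off the zeroth factor leaves the same product \<open>W\<close> on both sides,
  and 1 - 1/z = - (1 - z) / z.\<close>

lemma theta_prod_inverse:
  assumes "norm t < 1" "z \<noteq> 0"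
  shows "theta_prod t (inverse z) = - theta_prod t z / z"
proof -
  define W where "W = qpoch_inf (t / z) t * qpoch_inf (z * t) t"
  have "theta_prod t (inverse z) = (1 - inverse z) * W"
    unfolding theta_prod_def W_def qpoch_inf_shift[OF assms(1), of "inverse z"] by (simp add: field_simps)
  also have "\<dots> = - ((1 - z) * W) / z" using assms(2) by (simp add: field_simps)
  also have "(1 - z) * W = theta_prod t z"
    unfolding theta_prod_def W_def qpoch_inf_shift[OF assms(1), of z] by (simp add: mult_ac)
  finally show ?thesis .
qed

text \<open>After division by \<open>x y\<close> the right-hand side is a \<open>2 \<times> 2\<close> determinant in \<open>x\<close> and \<open>y\<close>, so the
  three-term relation below is the Pluecker relation.\<close>

lemma theta_prod_mult:
  assumes "s \<noteq> 0" "norm s < 1" "x \<noteq> 0" "y \<noteq> 0"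
  defines "A \<equiv> \<lambda>x. bilateral_theta (s ^ 2) (x ^ 2 / s ^ 2)" and "B \<equiv> \<lambda>x. bilateral_theta (s ^ 2) (x ^ 2)"
  shows "qpoch_inf (s ^ 2) (s ^ 2) ^ 2 * (theta_prod (s ^ 2) (x * y) * theta_prod (s ^ 2) (x / y)) =
    A x * B y - x / y * (B x * A y)"
proof -
  have s2: "s ^ 2 \<noteq> 0" "norm (s ^ 2) < 1"
    using assms by (simp_all add: norm_power power_less_one_iff)
  \<comment> \<open>The product formula for bilateral series is applied with
    \<open>- (x / s)\<close> in place of \<open>x\<close>, absorbing the shift between
    \<open>theta_prod\<close> and \<open>bilateral_theta\<close>.\<close>
  have "(- (x / s)) * y = - (x * y / s)" "(- (x / s)) / y = - (x / y / s)" by simp_all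
  then have "qpoch_inf (s ^ 2) (s ^ 2) ^ 2 * (theta_prod (s ^ 2) (x * y) * theta_prod (s ^ 2) (x / y)) =
      bilateral_theta s ((- (x / s)) * y) * bilateral_theta s ((- (x / s)) / y)"
    using theta_prod_eq_bilateral_theta[OF assms(1,2), of "x * y"]
      theta_prod_eq_bilateral_theta[OF assms(1,2), of "x / y"] assms
    by (simp add: power2_eq_square[of "qpoch_inf _ _"] mult_ac)
  also have "\<dots> = bilateral_theta (s ^ 2) ((- (x / s)) ^ 2) * bilateral_theta (s ^ 2) (y ^ 2)
      + s * (- (x / s)) * y * bilateral_theta (s ^ 2) (s ^ 2 * (- (x / s)) ^ 2) * bilateral_theta (s ^ 2) (s ^ 2 * y ^ 2)"
    using assms by (intro bilateral_theta_mult) auto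
  also have "(- (x / s)) ^ 2 = x ^ 2 / s ^ 2" by (simp add: power_divide)
  also have "s ^ 2 * (x ^ 2 / s ^ 2) = x ^ 2" using assms by simp
  also have "s * (- (x / s)) * y * bilateral_theta (s ^ 2) (x ^ 2) * bilateral_theta (s ^ 2) (s ^ 2 * y ^ 2) = - (x / y * (B x * A y))"
  proof -
    \<comment> \<open>One quasi-period shift identifies the remaining series with the function
      \<open>A\<close>, which makes the determinant appear.\<close>
    have "A y = y ^ 2 * bilateral_theta (s ^ 2) (s ^ 2 * y ^ 2)"
    proof -
      have "s ^ 2 * (y ^ 2 / s ^ 2) = y ^ 2" "(s ^ 2) ^ 2 * (y ^ 2 / s ^ 2) = s ^ 2 * y ^ 2"
        using assms(1) by (simp_all add: power2_eq_square)
      then show ?thesis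
        using bilateral_theta_shift[OF s2, of "y ^ 2 / s ^ 2"] assms(1,4) by (simp add: A_def)
    qed
    moreover have "s * (- (x / s)) * y * b * c = - (x / y * (b * (y ^ 2 * c)))" for b c
      using assms(1,4) by (simp add: power2_eq_square)
    ultimately show ?thesis by (simp only: B_def)
  qed
  finally show ?thesis by (simp add: A_def B_def)
qed

lemma weierstrass_three_term:
  assumes "s \<noteq> 0" "norm s < 1" "y \<noteq> 0" "u \<noteq> 0" "v \<noteq> 0"
  defines "J \<equiv> theta_prod (s ^ 2)"
  shows "J u ^ 2 * (J (y * v) * J (y / v)) =
    J y ^ 2 * (J (u * v) * J (u / v)) + u / v * (J v ^ 2 * (J (y * u) * J (y / u)))"
proof -
  define A where "A = (\<lambda>x. bilateral_theta (s ^ 2) (x ^ 2 / s ^ 2))"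
  define B where "B = (\<lambda>x. bilateral_theta (s ^ 2) (x ^ 2))"
  define K where "K = qpoch_inf (s ^ 2) (s ^ 2) ^ 2"
  have s2: "norm (s ^ 2) < 1" using assms by (simp add: norm_power power_less_one_iff)
  then have K: "K \<noteq> 0" unfolding K_def by (simp add: qpoch_inf_nonzero)
  have D: "K * (J (a * b) * J (a / b)) = A a * B b - a / b * (B a * A b)" if "a \<noteq> 0" "b \<noteq> 0" for a b
    using theta_prod_mult[OF assms(1,2) that] by (simp add: J_def A_def B_def K_def)
  \<comment> \<open>The fourth point of the Pluecker relation is 1: its determinants with
    \<open>y\<close>, \<open>u\<close>, \<open>v\<close> give the squares, since J(a) J(1/a) = -
    J(a)^2 / a.\<close>
  have sq: "K * J a ^ 2 = B 1 * A a - a * (A 1 * B a)" if "a \<noteq> 0" for a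
  proof -
    have "J (1 / a) = - J a / a"
      using theta_prod_inverse[OF s2 that] by (simp add: J_def inverse_eq_divide)
    then have "K * (J a * (- J a / a)) = A 1 * B a - 1 / a * (B 1 * A a)"
      using D[of 1 a] that by simp
    then have "- a * (K * (J a * (- J a / a))) = - a * (A 1 * B a - 1 / a * (B 1 * A a))" by simp
    then show ?thesis using that by (simp add: power2_eq_square right_diff_distrib)
  qed
  have "K ^ 2 * (J u ^ 2 * (J (y * v) * J (y / v))) = (K * J u ^ 2) * (K * (J (y * v) * J (y / v)))"
    by (simp add: power2_eq_square)
  also have "\<dots> = (K * J y ^ 2) * (K * (J (u * v) * J (u / v))) +
      u / v * ((K * J v ^ 2) * (K * (J (y * u) * J (y / u))))"
    using assms(3-5)
    unfolding D[OF assms(3,5)] D[OF assms(4,5)] D[OF assms(3,4)] sq[OF assms(3)] sq[OF assms(4)] sq[OF assms(5)]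
    by (simp add: field_simps)
  also have "\<dots> = K ^ 2 * (J y ^ 2 * (J (u * v) * J (u / v)) + u / v * (J v ^ 2 * (J (y * u) * J (y / u))))"
    by (simp add: power2_eq_square algebra_simps)
  finally show ?thesis using K by simp
qed

section \<open>Level twelve\<close>

text \<open>Here \<open>a\<close> and \<open>b\<close> stand for \<open>P ^ 4\<close> and
  \<open>Q ^ 4\<close>, and a/b + b/a + 2 for \<open>X ^ 2\<close>. The linear factors in
  \<open>p\<close> stay atomic while denominators are cleared by \<open>D\<close>; only then is
  everything expanded in \<open>p\<close>.\<close>

lemma modular_parametrisation_identity:
  fixes p a b :: complex
  assumes "p \<noteq> 0" "1 - p \<noteq> 0" "1 + p \<noteq> 0" "1 + 2 * p \<noteq> 0" "2 + p \<noteq> 0"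
    and a: "a = (1 - p) ^ 2 * (1 + 2 * p) * (2 + p) / (p * (1 + p) ^ 2)"
    and b: "b = (2 + p) ^ 2 * (1 + 2 * p) * (1 - p) / (p ^ 2 * (1 + p))"
  shows "a + b + 81 / a + 81 / b = (a / b + b / a + 2) ^ 2 - 11 * (a / b + b / a + 2) - 8"
proof -
  define x y z w where "x = 1 - p" and "y = 1 + p" and "z = 1 + 2 * p" and "w = 2 + p"
  have nz: "x \<noteq> 0" "y \<noteq> 0" "z \<noteq> 0" "w \<noteq> 0" using assms by (simp_all add: x_def y_def z_def w_def)
  define D where "D = p ^ 2 * x ^ 2 * y ^ 2 * z * w ^ 2"
  have D: "D \<noteq> 0" using nz assms(1) by (simp add: D_def)
  \<comment> \<open>Most factors cancel in the quotient: a/b =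
    \<open>p * x / (y * w)\<close>.\<close>
  have ab: "a / b + b / a + 2 = ((p * x) ^ 2 + (y * w) ^ 2 + 2 * (p * x * y * w)) / (p * x * y * w)"
    unfolding a b x_def[symmetric] y_def[symmetric] z_def[symmetric] w_def[symmetric]
    using nz assms(1) by (simp add: field_simps power2_eq_square)
  have "D * (a + b + 81 / a + 81 / b) =
      z ^ 2 * (p * x ^ 4 * w ^ 3 + x ^ 3 * y * w ^ 4) + 81 * (p ^ 3 * y ^ 4 * w + p ^ 4 * x * y ^ 3)"
    unfolding a b x_def[symmetric] y_def[symmetric] z_def[symmetric] w_def[symmetric] D_def
    using nz assms(1) by (simp add: field_simps power2_eq_square power3_eq_cube power4_eq_xxxx)
  also have "\<dots> = z * (((p * x) ^ 2 + (y * w) ^ 2 + 2 * (p * x * y * w)) ^ 2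
      - 11 * ((p * x) ^ 2 + (y * w) ^ 2 + 2 * (p * x * y * w)) * (p * x * y * w) - 8 * (p * x * y * w) ^ 2)"
    unfolding x_def y_def z_def w_def by algebra
  also have "\<dots> = D * ((a / b + b / a + 2) ^ 2 - 11 * (a / b + b / a + 2) - 8)"
  proof -
    have scale: "z * (N ^ 2 - 11 * N * M - 8 * M ^ 2) = z * M ^ 2 * ((N / M) ^ 2 - 11 * (N / M) - 8)"
      if "M \<noteq> 0" for N M :: complex
      using that by (simp add: field_simps power2_eq_square)
    have D_eq: "D = z * (p * x * y * w) ^ 2" by (simp add: D_def power_mult_distrib)
    have "p * x * y * w \<noteq> 0" using nz assms(1) by simp
    then show ?thesis unfolding ab D_eq by (rule scale)
  qed
  finally show ?thesis using D by simp
qed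

section \<open>Special values of theta products with base \<open>q ^ 6\<close>\<close>

context
  fixes q :: complex
  assumes q: "q \<noteq> 0" "norm q < 1"
begin

abbreviation "qp a \<equiv> qpoch_inf a (q ^ 6)"
abbreviation "J \<equiv> theta_prod (q ^ 6)"

lemma norm_power_less_1: "n > 0 \<Longrightarrow> norm (q ^ n) < 1"
  using q by (simp add: norm_power power_less_one_iff)

lemma qp_nonzero: "n > 0 \<Longrightarrow> qp (q ^ n) \<noteq> 0" "n > 0 \<Longrightarrow> qp (- (q ^ n)) \<noteq> 0"
  using norm_power_less_1 by (simp_all add: qpoch_inf_nonzero)

lemma qpoch_inf_even_power: "qpoch_inf (q ^ (2 * n)) (q ^ 12) = qp (q ^ n) * qp (- (q ^ n))"
  using qpoch_inf_square[OF norm_power_less_1[of 6], of "q ^ n"]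
  by (simp add: power_mult[symmetric] mult.commute)

lemma theta_values:
  "J q = qp q * qp (q ^ 5)" "J (q ^ 2) = qp (q ^ 2) * qp (q ^ 4)" "J (q ^ 3) = qp (q ^ 3) ^ 2"
  "J (- 1) = 2 * qp (- (q ^ 6)) ^ 2"
  "J (- q) = qp (- q) * qp (- (q ^ 5))" "J (- (q ^ 2)) = qp (- (q ^ 2)) * qp (- (q ^ 4))"
  "J (- (q ^ 3)) = qp (- (q ^ 3)) ^ 2"
proof -
  have "q ^ 6 / q = q ^ 5" "q ^ 6 / q ^ 2 = q ^ 4" "q ^ 6 / q ^ 3 = q ^ 3"
    using power_diff[OF q(1), of 1 6] power_diff[OF q(1), of 2 6] power_diff[OF q(1), of 3 6] by simp_all
  \<comment> \<open>The zeroth factor 1 - (-1) supplies the 2.\<close>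
  moreover have "qp (- 1) = 2 * qp (- (q ^ 6))"
    using qpoch_inf_shift[OF norm_power_less_1[of 6], of "- 1"] by simp
  ultimately show "J q = qp q * qp (q ^ 5)" "J (q ^ 2) = qp (q ^ 2) * qp (q ^ 4)" "J (q ^ 3) = qp (q ^ 3) ^ 2"
    "J (- 1) = 2 * qp (- (q ^ 6)) ^ 2"
    "J (- q) = qp (- q) * qp (- (q ^ 5))" "J (- (q ^ 2)) = qp (- (q ^ 2)) * qp (- (q ^ 4))"
    "J (- (q ^ 3)) = qp (- (q ^ 3)) ^ 2"
    by (simp_all add: theta_prod_def power2_eq_square)
qed

lemma theta_values_nonzero:
  "J q \<noteq> 0" "J (q ^ 2) \<noteq> 0" "J (q ^ 3) \<noteq> 0" "J (- 1) \<noteq> 0" "J (- q) \<noteq> 0" "J (- (q ^ 2)) \<noteq> 0" "J (- (q ^ 3)) \<noteq> 0"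
  unfolding theta_values using qp_nonzero qp_nonzero[of 1] by simp_all

lemma qpoch_inf_power_split:
  assumes "0 < k" "0 < m"
  shows "qpoch_inf (q ^ k) (q ^ k) = (\<Prod>j<m. qpoch_inf (q ^ (k + k * j)) (q ^ (k * m)))"
  using qpoch_inf_split[OF norm_power_less_1[OF assms(1)] assms(2)]
  by (simp add: power_add power_mult)

text \<open>Exponents 1, 2, 3 are dissected down to base \<open>q ^ 6\<close>. Exponent 4 only
  reaches base \<open>q ^ 12\<close>, where each factor splits into a pair with opposite
  signs.\<close>

lemma euler_products:
  shows "qpoch_inf q q = J q * J (q ^ 2) * qp (q ^ 3) * qp (q ^ 6)"
    and "qpoch_inf (q ^ 2) (q ^ 2) = J (q ^ 2) * qp (q ^ 6)"
    and "qpoch_inf (q ^ 3) (q ^ 3) = qp (q ^ 3) * qp (q ^ 6)"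
    and "qpoch_inf (q ^ 4) (q ^ 4) = J (q ^ 2) * J (- (q ^ 2)) * qp (q ^ 6) * qp (- (q ^ 6))"
    and "qpoch_inf (q ^ 12) (q ^ 12) = qp (q ^ 6) * qp (- (q ^ 6))"
proof -
  note ev = qpoch_inf_even_power[of 2, simplified] qpoch_inf_even_power[of 4, simplified]
    qpoch_inf_even_power[of 6, simplified]
  show "qpoch_inf q q = J q * J (q ^ 2) * qp (q ^ 3) * qp (q ^ 6)"
    using qpoch_inf_power_split[of 1 6]
    by (simp add: lessThan_nat_numeral lessThan_Suc theta_values del: power_Suc flip: numeral_2_eq_2)
  show "qpoch_inf (q ^ 2) (q ^ 2) = J (q ^ 2) * qp (q ^ 6)"
    using qpoch_inf_power_split[of 2 3]
    by (simp add: lessThan_nat_numeral lessThan_Suc theta_values del: power_Suc flip: numeral_2_eq_2)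
  show "qpoch_inf (q ^ 3) (q ^ 3) = qp (q ^ 3) * qp (q ^ 6)"
    using qpoch_inf_power_split[of 3 2]
    by (simp add: lessThan_nat_numeral lessThan_Suc theta_values del: power_Suc flip: numeral_2_eq_2)
  show "qpoch_inf (q ^ 4) (q ^ 4) = J (q ^ 2) * J (- (q ^ 2)) * qp (q ^ 6) * qp (- (q ^ 6))"
    using qpoch_inf_power_split[of 4 3]
    by (simp add: lessThan_nat_numeral lessThan_Suc theta_values ev del: power_Suc flip: numeral_2_eq_2)
  show "qpoch_inf (q ^ 12) (q ^ 12) = qp (q ^ 6) * qp (- (q ^ 6))"
    by (rule ev)
qed

text \<open>The second product is Euler's (x; x^2)_oo (-x; x)_oo = 1 at x = \<open>q ^ 6\<close>;
  the first is the case x = \<open>q ^ 2\<close> divided by it. Each is found by dissecting an Euler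
  product to base \<open>q ^ 12\<close> and returning to base \<open>q ^ 6\<close>.\<close>

lemma theta_value_products:
  shows "J q * J (- q) * J (- (q ^ 2)) = 1"
    and "qp (q ^ 3) * qp (- (q ^ 3)) * qp (- (q ^ 6)) = 1"
proof -
  note ev = qpoch_inf_even_power[of 1, simplified] qpoch_inf_even_power[of 2, simplified]
    qpoch_inf_even_power[of 3, simplified] qpoch_inf_even_power[of 4, simplified]
    qpoch_inf_even_power[of 5, simplified] qpoch_inf_even_power[of 6, simplified]
  have "qp (q ^ 6) = qpoch_inf (q ^ 6) (q ^ 12) * qpoch_inf (q ^ 12) (q ^ 12)"
    using qpoch_inf_power_split[of 6 2] by (simp add: lessThan_nat_numeral lessThan_Suc del: power_Suc flip: numeral_2_eq_2)
  also have "\<dots> = qp (q ^ 6) * (qp (q ^ 3) * qp (- (q ^ 3)) * qp (- (q ^ 6)))"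
    unfolding ev by (simp only: mult_ac)
  finally show 1: "qp (q ^ 3) * qp (- (q ^ 3)) * qp (- (q ^ 6)) = 1"
    using qp_nonzero(1)[of 6] by simp
  have "J (q ^ 2) * qp (q ^ 6) = qpoch_inf (q ^ 2) (q ^ 12) * qpoch_inf (q ^ 4) (q ^ 12) *
      qpoch_inf (q ^ 6) (q ^ 12) * qpoch_inf (q ^ 8) (q ^ 12) * qpoch_inf (q ^ 10) (q ^ 12) *
      qpoch_inf (q ^ 12) (q ^ 12)"
    unfolding euler_products(2)[symmetric]
    using qpoch_inf_power_split[of 2 6]
    by (simp add: lessThan_nat_numeral lessThan_Suc mult_ac del: power_Suc flip: numeral_2_eq_2)
  also have "\<dots> = J q * J (- q) * J (- (q ^ 2)) * (J (q ^ 2) * qp (q ^ 6)) *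
      (qp (q ^ 3) * qp (- (q ^ 3)) * qp (- (q ^ 6)))"
    unfolding ev theta_values by (simp only: mult_ac)
  finally show "J q * J (- q) * J (- (q ^ 2)) = 1"
    using theta_values_nonzero(2) qp_nonzero(1)[of 6] by (simp add: 1)
qed

text \<open>These are the three-term relations for \<open>(y, u, v) = (q, q\<^sup>2, -1)\<close>, \<open>(q, q\<^sup>2, -q\<^sup>3)\<close>, \<open>(q, q\<^sup>2, -q)\<close> and
  \<open>(q\<^sup>2, -q, -q\<^sup>2)\<close>.\<close>

lemma theta_relations:
  shows "J (q ^ 2) ^ 2 * J (- q) ^ 2 = J q ^ 2 * J (- (q ^ 2)) ^ 2 + q * J (- 1) ^ 2 * J (q ^ 3) * J q"
    and "J (q ^ 2) ^ 2 * J (- (q ^ 2)) ^ 2 = q * J q ^ 2 * J (- q) ^ 2 + J (- (q ^ 3)) ^ 2 * J (q ^ 3) * J q"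
    and "J (q ^ 2) ^ 2 * J (- (q ^ 2)) * J (- 1) =
      J q ^ 2 * J (- (q ^ 3)) * J (- q) + J (- q) ^ 2 * J (q ^ 3) * J q"
    and "J (- (q ^ 2)) ^ 2 * J (- (q ^ 3)) * J (- q) =
      J (q ^ 2) ^ 2 * J (q ^ 3) * J q + q * J (- q) ^ 2 * J (- (q ^ 2)) * J (- 1)"
proof -
  have q6: "norm (q ^ 6) < 1" "q ^ 6 \<noteq> 0" using norm_power_less_1[of 6] q by auto
  have s: "q ^ 3 \<noteq> 0" "norm (q ^ 3) < 1" using norm_power_less_1[of 3] q by auto
  have s2: "(q ^ 3) ^ 2 = q ^ 6" by (simp flip: power_mult)
  have "- (q ^ 3) \<noteq> 0" "- (q ^ 2) \<noteq> 0" "- q \<noteq> 0" "q ^ 2 \<noteq> 0" "(- 1 :: complex) \<noteq> 0" using q by auto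
  note nz = this q(1)
  note W = weierstrass_three_term[OF s, unfolded s2]
  have pw: "q * q ^ 2 = q ^ 3" "q ^ 2 * q = q ^ 3" "q * q ^ 3 = q ^ 4" "q ^ 2 * q ^ 2 = q ^ 4" "q ^ 2 * q ^ 3 = q ^ 5"
    by (simp_all add: eval_nat_numeral)
  \<comment> \<open>Reflection and inversion bring every argument back to one of those in
    \<open>theta_values\<close>.\<close>
  have args: "q * - 1 = - q" "q / - 1 = - q" "q ^ 2 * - 1 = - (q ^ 2)" "q ^ 2 / - 1 = - (q ^ 2)"
    "q * q ^ 2 = q ^ 3" "q / q ^ 2 = inverse q" "q * - (q ^ 3) = - (q ^ 4)" "q / - (q ^ 3) = inverse (- (q ^ 2))"
    "q ^ 2 * - (q ^ 3) = - (q ^ 5)" "q ^ 2 / - (q ^ 3) = inverse (- q)" "q * - q = - (q ^ 2)" "q / - q = - 1"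
    "q ^ 2 * - q = - (q ^ 3)" "q ^ 2 / - q = - q" "q ^ 2 * - (q ^ 2) = - (q ^ 4)" "q ^ 2 / - (q ^ 2) = - 1"
    "- q * - (q ^ 2) = q ^ 3" "- q / - (q ^ 2) = inverse q"
    using q(1) pw by (simp_all add: power2_eq_square power3_eq_cube field_simps)
  have "q ^ 6 / - q = - (q ^ 5)" "q ^ 6 / - (q ^ 2) = - (q ^ 4)"
    using power_diff[OF q(1), of 1 6] power_diff[OF q(1), of 2 6] by simp_all
  then have refl: "J (- (q ^ 5)) = J (- q)" "J (- (q ^ 4)) = J (- (q ^ 2))"
    using theta_prod_reflect[OF q6(2) nz(3)] theta_prod_reflect[OF q6(2) nz(2)] by simp_all
  note inv = theta_prod_inverse[OF q6(1) q(1)] theta_prod_inverse[OF q6(1) nz(3)] theta_prod_inverse[OF q6(1) nz(2)]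
  note W1 = W[OF nz(6,4,5), unfolded args refl inv] and W2 = W[OF nz(6,4,1), unfolded args refl inv]
    and W3 = W[OF nz(6,4,3), unfolded args refl inv] and W4 = W[OF nz(4,3,2), unfolded args refl inv]
  define a b c d a' b' c' where "a = J q" and "b = J (q ^ 2)" and "c = J (q ^ 3)" and "d = J (- 1)"
    and "a' = J (- q)" and "b' = J (- (q ^ 2))" and "c' = J (- (q ^ 3))"
  note names = this[symmetric]
  show "J (q ^ 2) ^ 2 * J (- q) ^ 2 = J q ^ 2 * J (- (q ^ 2)) ^ 2 + q * J (- 1) ^ 2 * J (q ^ 3) * J q"
    using W1 q(1) unfolding names by (simp add: field_simps power2_eq_square)
  show "J (q ^ 2) ^ 2 * J (- (q ^ 2)) ^ 2 = q * J q ^ 2 * J (- q) ^ 2 + J (- (q ^ 3)) ^ 2 * J (q ^ 3) * J q"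
    using W2 q(1) unfolding names by (simp add: field_simps power2_eq_square)
  show "J (q ^ 2) ^ 2 * J (- (q ^ 2)) * J (- 1) =
      J q ^ 2 * J (- (q ^ 3)) * J (- q) + J (- q) ^ 2 * J (q ^ 3) * J q"
    using W3 q(1) unfolding names by (simp add: field_simps power2_eq_square)
  show "J (- (q ^ 2)) ^ 2 * J (- (q ^ 3)) * J (- q) =
      J (q ^ 2) ^ 2 * J (q ^ 3) * J q + q * J (- q) ^ 2 * J (- (q ^ 2)) * J (- 1)"
    using W4 q(1) unfolding names by (simp add: field_simps power2_eq_square)
qed

end

section \<open>The identity for P and Q through the level 12 parameter\<close>

theorem theorem3p5:
  fixes \<tau> q P Q X :: complex
  assumes "Im \<tau> > 0"
    and "q = exp (2 * of_real pi * \<i> * \<tau>)"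
    and "P = ramanujan_f (- q) * ramanujan_f (- (q ^ 2)) /
             (nome_power \<tau> (1/4) * ramanujan_f (- (q ^ 3)) * ramanujan_f (- (q ^ 6)))"
    and "Q = ramanujan_f (- (q ^ 2)) * ramanujan_f (- (q ^ 4)) /
             (nome_power \<tau> (1/2) * ramanujan_f (- (q ^ 6)) * ramanujan_f (- (q ^ 12)))"
    and "X = (P / Q) ^ 2 + (Q / P) ^ 2"
  shows "((P * Q) ^ 2 + (9 / (P * Q)) ^ 2) * X = X ^ 4 - 11 * X ^ 2 - 8"
proof -
  have q: "q \<noteq> 0" "norm q < 1"
    using assms(1) by (simp_all add: assms(2))
  define a b a' b' c c' d e where "a = theta_prod (q ^ 6) q" and "b = theta_prod (q ^ 6) (q ^ 2)"
    and "a' = theta_prod (q ^ 6) (- q)" and "b' = theta_prod (q ^ 6) (- (q ^ 2))"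
    and "c = qpoch_inf (q ^ 3) (q ^ 6)" and "c' = qpoch_inf (- (q ^ 3)) (q ^ 6)"
    and "d = qpoch_inf (- (q ^ 6)) (q ^ 6)" and "e = qpoch_inf (q ^ 6) (q ^ 6)"
  note names = this[symmetric]
  have nz: "a \<noteq> 0" "b \<noteq> 0" "a' \<noteq> 0" "b' \<noteq> 0" "c \<noteq> 0" "c' \<noteq> 0" "d \<noteq> 0" "e \<noteq> 0"
    using theta_values_nonzero[OF q] qp_nonzero[OF q, of 3] qp_nonzero[OF q, of 6]
    by (simp_all add: a_def b_def a'_def b'_def c_def c'_def d_def e_def)
  have J: "theta_prod (q ^ 6) (q ^ 3) = c ^ 2" "theta_prod (q ^ 6) (- 1) = 2 * d ^ 2"
      "theta_prod (q ^ 6) (- (q ^ 3)) = c' ^ 2"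
    unfolding theta_values[OF q] c_def c'_def d_def by simp_all
  have one: "a * a' * b' = 1" "c * c' * d = 1"
    unfolding a_def a'_def b'_def c_def c'_def d_def
    using theta_value_products[OF q] by simp_all
  note rel = theta_relations[OF q, unfolded J names]
  note euler = euler_products[OF q, unfolded names]
  \<comment> \<open>Only \<open>P ^ 4\<close> and \<open>Q ^ 4\<close> matter in the end, so the
    fractional powers of \<open>q\<close> enter only through these integral powers.\<close>
  have n: "nome_power \<tau> (1/4) ^ 4 = q" "nome_power \<tau> (1/2) ^ 2 = q"
    unfolding nome_power_def assms(2) by (simp_all add: mult_ac flip: exp_of_nat_mult)
  have P: "P = a * b ^ 2 / nome_power \<tau> (1/4)"
    unfolding assms(3) ramanujan_f_def minus_minus euler names
    using nz by (simp add: power2_eq_square)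
  have Q: "Q = b ^ 2 * b' / nome_power \<tau> (1/2)"
    unfolding assms(4) ramanujan_f_def minus_minus euler names
    using nz by (simp add: power2_eq_square)
  have P4: "P ^ 4 = a ^ 4 * b ^ 8 / q"
    unfolding P power_divide n power_mult_distrib by (simp flip: power_mult)
  have "Q ^ 4 = (b ^ 2 * b') ^ 4 / (nome_power \<tau> (1/2) ^ 2) ^ 2"
    unfolding Q power_divide by (simp flip: power_mult)
  then have Q4: "Q ^ 4 = b ^ 8 * b' ^ 4 / q ^ 2"
    unfolding n power_mult_distrib by (simp flip: power_mult)
  have PQ0: "P \<noteq> 0" "Q \<noteq> 0" unfolding P Q using nz by (simp_all add: nome_power_def)

  txt \<open>In terms of \<open>\<phi>(q) = \<Sum> q^(n\<^sup>2)\<close> this is the classical degree-three parameter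
    \<open>p = (\<phi>(q)\<^sup>2 - \<phi>(q\<^sup>3)\<^sup>2) / (2 \<phi>(q\<^sup>3)\<^sup>2)\<close>.\<close>
  define p where "p = 2 * q * a * a' ^ 2 * d ^ 4 * c ^ 2"
  have "p \<noteq> 0" unfolding p_def using nz q by simp
  \<comment> \<open>Each of \<open>p1\<close> to \<open>p4\<close> comes from one theta relation,
    \<open>p3\<close> using \<open>p2\<close> as well. Powers of \<open>a * a' * b'\<close> and
    \<open>c * c' * d\<close>, both equal to 1, are inserted to match the monomials.\<close>
  have "2 * p * (a ^ 2 * b' ^ 2) = q * (2 * d ^ 2) ^ 2 * c ^ 2 * a * (a * a' * b') ^ 2"
    unfolding p_def by algebra
  then have p1: "1 + 2 * p = b ^ 2 * a' ^ 2 / (a ^ 2 * b' ^ 2)"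
    using rel(1) nz unfolding one by (simp add: field_simps)
  have "p * (c' ^ 2) ^ 2 * c ^ 2 * a = 2 * q * a ^ 2 * a' ^ 2 * (c * c' * d) ^ 4"
    unfolding p_def by algebra
  then have "(2 + p) * (q * a ^ 2 * a' ^ 2) = p * (b ^ 2 * b' ^ 2)"
    unfolding rel(2) one by (simp add: algebra_simps)
  also have "\<dots> = (2 * d ^ 4 * c ^ 2 * b ^ 2 * b' ^ 2 / a) * (q * a ^ 2 * a' ^ 2)"
    using nz by (simp add: p_def power2_eq_square)
  finally have p2: "2 + p = 2 * d ^ 4 * c ^ 2 * b ^ 2 * b' ^ 2 / a"
    by (rule mult_right_cancel[THEN iffD1, rotated]) (use nz q in simp)
  have "(2 + p) * (a ^ 2 * c' ^ 2 * a') = 2 * d ^ 2 * b ^ 2 * b' * (a * a' * b') * (c * c' * d) ^ 2"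
    unfolding p2 using nz by (simp add: field_simps power2_eq_square power4_eq_xxxx)
  also have "\<dots> = a ^ 2 * c' ^ 2 * a' + a' ^ 2 * c ^ 2 * a"
    using rel(3) unfolding one by (simp add: mult_ac)
  finally have "a * a' * ((1 + p) * (a * c' ^ 2)) = a * a' * (a' * c ^ 2)"
    by (simp add: algebra_simps power2_eq_square)
  then have "(1 + p) * (a * c' ^ 2) = a' * c ^ 2"
    by (rule mult_left_cancel[THEN iffD1, rotated]) (use nz in simp)
  then have p3: "1 + p = a' * c ^ 2 / (a * c' ^ 2)"
    by (rule nonzero_eq_divide_eq[THEN iffD2, rotated]) (use nz in simp)
  have "p * (b' ^ 2 * c' ^ 2 * a') = q * a' ^ 2 * b' * (2 * d ^ 2) * (a * a' * b') * (c * c' * d) ^ 2"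
    unfolding p_def by algebra
  then have "(1 - p) * (b' ^ 2 * c' ^ 2 * a') = b ^ 2 * c ^ 2 * a"
    unfolding one left_diff_distrib[of 1 p "b' ^ 2 * c' ^ 2 * a'"] using rel(4) by simp
  then have p4: "1 - p = b ^ 2 * c ^ 2 * a / (b' ^ 2 * c' ^ 2 * a')"
    by (rule nonzero_eq_divide_eq[THEN iffD2, rotated]) (use nz in simp)
  \<comment> \<open>Eliminating \<open>b'\<close> and \<open>d\<close> uses up both product
    relations, so the two parametrisations below become equalities of monomials in the remaining
    letters.\<close>
  have b': "b' = 1 / (a * a')" and d: "d = 1 / (c * c')"
    using one nz by (simp_all add: field_simps)
  have "P ^ 4 = (1 - p) ^ 2 * (1 + 2 * p) * (2 + p) / (p * (1 + p) ^ 2)"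
    unfolding P4 p1 p2 p3 p4 unfolding p_def b' d using nz(1-3,5,6) q(1)
    by (simp add: divide_simps) (simp add: eval_nat_numeral mult_ac)
  moreover have "Q ^ 4 = (2 + p) ^ 2 * (1 + 2 * p) * (1 - p) / (p ^ 2 * (1 + p))"
    unfolding Q4 p1 p2 p3 p4 unfolding p_def b' d using nz(1-3,5,6) q(1)
    by (simp add: divide_simps) (simp add: eval_nat_numeral mult_ac)
  moreover have "1 + p \<noteq> 0" "1 - p \<noteq> 0" "1 + 2 * p \<noteq> 0" "2 + p \<noteq> 0"
    unfolding p1 p2 p3 p4 using nz q \<open>p \<noteq> 0\<close> by simp_all
  ultimately have "P ^ 4 + Q ^ 4 + 81 / P ^ 4 + 81 / Q ^ 4 =
      (P ^ 4 / Q ^ 4 + Q ^ 4 / P ^ 4 + 2) ^ 2 - 11 * (P ^ 4 / Q ^ 4 + Q ^ 4 / P ^ 4 + 2) - 8"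
    using \<open>p \<noteq> 0\<close> by (intro modular_parametrisation_identity)
  moreover have "X ^ 2 = P ^ 4 / Q ^ 4 + Q ^ 4 / P ^ 4 + 2"
    unfolding assms(5) using PQ0 by (simp add: power2_sum power_divide flip: power_mult)
  \<comment> \<open>Multiplying out, (PQ)^2 X = P^4 + Q^4, and 81 X / (PQ)^2 gives the two
    reciprocal terms.\<close>
  moreover have "((P * Q) ^ 2 + (9 / (P * Q)) ^ 2) * X = P ^ 4 + Q ^ 4 + 81 / P ^ 4 + 81 / Q ^ 4"
    unfolding assms(5) using PQ0 by (simp add: field_simps flip: power_add)
  moreover have "X ^ 4 = (X ^ 2) ^ 2" by simp
  ultimately show ?thesis by (simp only:)
qed

end
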